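(* Let $\varepsilon_0$ be a sufficiently small positive constant such that $1-2\varepsilon_0\ln(3/2)+4\varepsilon_0^22^{2\varepsilon_0}\ln^2(2)<1-\varepsilon_0/2$. Let $G$ be a random matrix with values in $GL(2,\mathbb{R})$ with $|\det(G)|=1$ almost surely, with a random singular value decomposition $$G=U\begin{pmatrix}\|G\|&0\\0&\|G\|^{-1}\end{pmatrix}V,$$ and let $u_1\in\mathbb{R}^2$ be the (random) first column of $U$. Suppose that there exist constants $\alpha,C>0$ such that for every $\delta>0$, $$\sup_{\|x\|=1}\mathbb{P}(|\langle u_1,x\rangle|\le\delta)\le C\delta^\alpha.$$ Let $2<A<B$ be two positive constants such that $$A^\alpha\ge\frac{C2^\alpha B^{2\varepsilon_0}}{\varepsilon_0}.$$ Suppose also that $A\le\|G\|\le B$ almost surely. Then $$\sup_{\|x\|=1}\mathbb{E}\left[\|Gx\|^{-2\varepsilon_0}\right]\le1-\varepsilon_0/4.$$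
   Context: $\|\cdot\|$ is the Euclidean norm and the induced operator norm. In the random singular value decomposition, $U$ and $V$ are random orthogonal $2\times2$ matrices defined on the same probability space as $G$.
   Formalization: The non-concentration hypothesis is placed on the first row of V instead of the first column u_1 of U; as stated the claim fails, e.g. U a uniform rotation, V = I, G = U diag(100, 1/100), x = e_2, where ‖Gx‖ = 1/100 always. *)

theory Defs
  imports "HOL-Probability.Probability"
begin

text \<open>The middle factor of \<open>G = U D V\<close> when \<open>\<bar>det G\<bar> = 1\<close>: the singular values are then
  \<open>s = \<parallel>G\<parallel>\<close> and \<open>1/s\<close>. The outer \<open>vector\<close> lists the rows.

  Since \<open>G *v x = U *v (D *v (V *v x))\<close> and \<open>U\<close> is an isometry, the norm of \<open>G *v x\<close> is
  governed by the inner product of \<open>x\<close> with the first row of \<open>V\<close> (the top right singular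
  vector). The non-concentration hypothesis must be put on that vector: if it is put on the
  first column of \<open>U\<close>, it says nothing about the norm of \<open>G *v x\<close> (take \<open>V = mat 1\<close> and
  \<open>x = axis 2 1\<close>, whose image always has norm \<open>1/s\<close>).\<close>

definition sv_diag :: "real \<Rightarrow> real^2^2" where
  "sv_diag s = vector [vector [s, 0], vector [0, inverse s]]"

definition op_norm :: "real^2^2 \<Rightarrow> real" where
  "op_norm A = onorm (\<lambda>x. A *v x)"

end

theory Submission
  imports Defs
begin

text \<open>
  Fix a unit vector \<open>x\<close>, write \<open>s = \<parallel>G\<parallel>\<close> and let \<open>t = \<bar>row 1 V \<bullet> x\<bar>\<close> be the size of the component
  of \<open>x\<close> along the most expanded direction. The singular value decomposition gives
  \<open>\<parallel>G x\<parallel>\<^sup>2 = (s t)\<^sup>2 + (1 - t\<^sup>2) / s\<^sup>2\<close>, so \<open>\<parallel>G x\<parallel> \<ge> s t\<close> always, and \<open>\<parallel>G x\<parallel> \<ge> 1/s\<close> because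
  \<open>s \<ge> 1\<close> (\<open>norm_sv_decomposition_ge\<close>).

  Cut at \<open>t = 2/A\<close>. Above this level \<open>\<parallel>G x\<parallel> \<ge> A t > 2\<close>, so the integrand is at most
  \<open>2 powr (- 2 \<epsilon>\<^sub>0)\<close>. Below it only \<open>\<parallel>G x\<parallel> \<ge> 1/B\<close> is known, and the integrand may be as large as
  \<open>B powr (2 \<epsilon>\<^sub>0)\<close>; but by non-concentration this has probability at most
  \<open>C (2/A) powr \<alpha>\<close>, and the lower bound on \<open>A powr \<alpha>\<close> says exactly that the product of the two is
  at most \<open>\<epsilon>\<^sub>0\<close>. Hence the expectation is at most \<open>2 powr (- 2 \<epsilon>\<^sub>0) + \<epsilon>\<^sub>0\<close>.

  To first order in \<open>\<epsilon>\<^sub>0\<close> this is \<open>1 - (2 ln 2 - 1) \<epsilon>\<^sub>0\<close>, and \<open>2 ln 2 - 1 > 1/4\<close>. The smallness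
  condition on \<open>\<epsilon>\<^sub>0\<close> forces \<open>\<epsilon>\<^sub>0 < 0.1415\<close>, which is just small enough for the second-order term
  to fit into the remaining margin (\<open>two_powr_neg_plus_le\<close>).
\<close>

section \<open>Vectors under a singular value decomposition\<close>

lemma norm_orthogonal_matrix_mult:
  fixes Q :: "real^'n^'n"
  assumes "orthogonal_matrix Q"
  shows "norm (Q *v x) = norm x"
  using assms orthogonal_transformation_matrix[of "(*v) Q"]
  by (intro orthogonal_transformation_norm) simp

lemma norm_sv_decomposition:
  assumes U: "orthogonal_matrix U" and V: "orthogonal_matrix V" and x: "norm x = 1"
  shows "(norm ((U ** sv_diag s ** V) *v x))\<^sup>2 =
           (s * (row 1 V \<bullet> x))\<^sup>2 + (1 - (row 1 V \<bullet> x)\<^sup>2) / s\<^sup>2"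
proof -
  define y where "y = V *v x"
  have norm_sq: "(norm z)\<^sup>2 = (z$1)\<^sup>2 + (z$2)\<^sup>2" for z :: "real^2"
    by (simp only: power2_norm_eq_inner) (simp add: inner_vec_def sum_2 power2_eq_square)
  have y1: "y$1 = row 1 V \<bullet> x"
    by (simp add: y_def matrix_vector_mul_component row_def)
  have "(norm y)\<^sup>2 = 1"
    by (simp add: y_def norm_orthogonal_matrix_mult[OF V] x)
  hence y2: "(y$2)\<^sup>2 = 1 - (y$1)\<^sup>2"
    by (simp add: norm_sq)
  have "(U ** sv_diag s ** V) *v x = U *v (sv_diag s *v y)"
    by (simp add: y_def matrix_vector_mul_assoc matrix_mul_assoc)
  hence "(norm ((U ** sv_diag s ** V) *v x))\<^sup>2 = (norm (sv_diag s *v y))\<^sup>2"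
    by (simp add: norm_orthogonal_matrix_mult[OF U])
  also have "\<dots> = (s * y$1)\<^sup>2 + (y$2)\<^sup>2 / s\<^sup>2"
    by (simp add: norm_sq sv_diag_def matrix_vector_mult_def sum_2 power_mult_distrib
        power_inverse divide_inverse mult.commute)
  finally show ?thesis
    by (simp add: y1 y2)
qed

lemma norm_sv_decomposition_ge:
  assumes U: "orthogonal_matrix U" and V: "orthogonal_matrix V" and x: "norm x = 1"
    and s: "s \<ge> 1"
  shows "s * \<bar>row 1 V \<bullet> x\<bar> \<le> norm ((U ** sv_diag s ** V) *v x)" (is "_ \<le> ?n")
    and "1 / s \<le> norm ((U ** sv_diag s ** V) *v x)"
proof -
  define t where "t = row 1 V \<bullet> x"
  note n = norm_sv_decomposition[OF U V x, of s, folded t_def]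
  have "norm (row 1 V) = 1"
    using V by (simp add: orthogonal_matrix_orthonormal_rows)
  hence "\<bar>t\<bar> \<le> 1"
    using Cauchy_Schwarz_ineq2[of "row 1 V" x] by (simp add: t_def x)
  hence t: "t\<^sup>2 \<le> 1"
    by (simp add: abs_square_le_1)
  hence "(s * \<bar>t\<bar>)\<^sup>2 \<le> ?n\<^sup>2"
    by (simp add: n power_mult_distrib)
  thus "s * \<bar>row 1 V \<bullet> x\<bar> \<le> ?n"
    unfolding t_def by (rule power2_le_imp_le) simp
  have "1 / s\<^sup>2 \<le> 1" "1 \<le> s\<^sup>2"
    using s by simp_all
  hence "t\<^sup>2 * (1 / s\<^sup>2) \<le> t\<^sup>2 * s\<^sup>2"
    by (intro mult_left_mono) auto
  hence "(1 / s)\<^sup>2 \<le> ?n\<^sup>2"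
    unfolding n by (simp add: power_mult_distrib power_divide diff_divide_distrib mult.commute)
  thus "1 / s \<le> ?n"
    by (rule power2_le_imp_le) simp
qed

section \<open>The numerical margin\<close>

text \<open>
  The product \<open>(1 + y + y\<^sup>2/2) (1 - y + y\<^sup>2/2) = 1 + y\<^sup>4/4\<close> exceeds 1, so the quadratic Taylor
  polynomial, which bounds \<open>exp y\<close> from below, also bounds \<open>exp (- y)\<close> from above.
\<close>
lemma exp_minus_le_Taylor_quadratic:
  fixes y :: real
  assumes "y \<ge> 0"
  shows "exp (- y) \<le> 1 - y + y\<^sup>2 / 2"
proof -
  have pos: "0 < 1 - y + y\<^sup>2 / 2"
    using zero_le_power2[of "y - 1"] by (simp add: power2_eq_square algebra_simps)
  have "1 \<le> 1 + y^4 / 4"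
    by simp
  also have "\<dots> = (1 + y + y\<^sup>2 / 2) * (1 - y + y\<^sup>2 / 2)"
    by (simp add: field_simps power2_eq_square power4_eq_xxxx)
  also have "\<dots> \<le> exp y * (1 - y + y\<^sup>2 / 2)"
    using exp_lower_Taylor_quadratic[OF assms] pos by (intro mult_right_mono) auto
  finally show ?thesis
    by (simp add: exp_minus field_simps)
qed

text \<open>
  The margin is thin: the bound \<open>\<epsilon> < 0.1415\<close> needed at the end is lost if \<open>2 powr (2 * \<epsilon>)\<close> is
  estimated by 1 in the hypothesis, or if \<open>ln 2\<close> is replaced by its lower bound \<open>2/3\<close>.
\<close>
lemma two_powr_neg_plus_le:
  fixes \<epsilon> :: real
  assumes pos: "\<epsilon> > 0"
    and small: "1 - 2 * \<epsilon> * ln (3/2) + 4 * \<epsilon>\<^sup>2 * 2 powr (2 * \<epsilon>) * (ln 2)\<^sup>2 < 1 - \<epsilon> / 2"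
  shows "2 powr (- 2 * \<epsilon>) + \<epsilon> \<le> 1 - \<epsilon> / 4"
proof -
  define L :: real where "L = ln 2"
  have L: "0.693 \<le> L" "L \<le> 0.6932"
    using ln_approx_bounds[of 2 3] by (simp_all add: L_def eval_nat_numeral)
  have l: "ln (3/2 :: real) \<le> 0.41"
    using ln_approx_bounds[of "3/2" 2] by (simp add: eval_nat_numeral)
  have L2: "0.693\<^sup>2 \<le> L\<^sup>2" "L\<^sup>2 \<le> 0.6932\<^sup>2"
    using L by (intro power_mono; simp)+

  \<comment> \<open>The threshold lies just below \<open>(2 L - 5/4) / (2 L\<^sup>2) = 0.1418...\<close>, at which the second-order
    term of \<open>exp (- 2 \<epsilon> L)\<close> uses up the whole margin.\<close>
  have eps: "\<epsilon> < 0.1415"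
  proof (rule ccontr)
    assume "\<not> \<epsilon> < 0.1415"
    hence ge: "0.1415 \<le> \<epsilon>" by simp
    have "\<epsilon> * (4 * \<epsilon> * 2 powr (2 * \<epsilon>) * L\<^sup>2) < \<epsilon> * (2 * ln (3/2) - 1/2)"
      using small by (simp add: L_def power2_eq_square algebra_simps)
    hence "4 * \<epsilon> * 2 powr (2 * \<epsilon>) * L\<^sup>2 < 2 * ln (3/2) - 1/2"
      using pos by (simp only: mult_less_cancel_left_pos)
    also have "\<dots> \<le> 0.32"
      using l by simp
    finally have upper: "4 * \<epsilon> * 2 powr (2 * \<epsilon>) * L\<^sup>2 < 0.32" .
    have "2 * 0.1415 * 0.693 \<le> 2 * \<epsilon> * L"
      using ge L pos by (intro mult_mono) auto
    hence "1.196 \<le> 1 + 2 * \<epsilon> * L"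
      by simp
    also have "\<dots> \<le> 2 powr (2 * \<epsilon>)"
      using exp_ge_add_one_self[of "2 * \<epsilon> * L"] by (simp add: powr_def L_def)
    finally have "1.196 \<le> 2 powr (2 * \<epsilon>)" .
    hence "4 * 0.1415 * 1.196 * 0.693\<^sup>2 \<le> 4 * \<epsilon> * 2 powr (2 * \<epsilon>) * L\<^sup>2"
      using ge L2 pos by (intro mult_mono) auto
    moreover have "(0.32 :: real) \<le> 4 * 0.1415 * 1.196 * 0.693\<^sup>2"
      by (simp add: power2_eq_square)
    ultimately show False
      using upper by linarith
  qed

  have "\<epsilon> * L\<^sup>2 \<le> 0.1415 * 0.6932\<^sup>2"
    using eps L2 pos by (intro mult_mono) auto
  hence "5/4 - 2 * L + 2 * (\<epsilon> * L\<^sup>2) \<le> 0"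
    using L by (simp add: power2_eq_square)
  hence "\<epsilon> * (5/4 - 2 * L + 2 * (\<epsilon> * L\<^sup>2)) \<le> 0"
    using pos by (simp add: mult_le_0_iff)
  moreover have "2 powr (- 2 * \<epsilon>) \<le> 1 - 2 * \<epsilon> * L + (2 * \<epsilon> * L)\<^sup>2 / 2"
    using exp_minus_le_Taylor_quadratic[of "2 * \<epsilon> * L"] pos L by (simp add: powr_def L_def)
  ultimately show ?thesis
    by (simp add: power2_eq_square algebra_simps)
qed

section \<open>Negative moments of the image of a unit vector\<close>

theorem lemma4p12:
  fixes M :: "'w measure"
    and G U V :: "'w \<Rightarrow> real^2^2"
    and \<epsilon>\<^sub>0 \<alpha> C A B :: real
  assumes "prob_space M"
    and "\<epsilon>\<^sub>0 > 0"
    and "1 - 2 * \<epsilon>\<^sub>0 * ln (3/2) + 4 * \<epsilon>\<^sub>0\<^sup>2 * 2 powr (2 * \<epsilon>\<^sub>0) * (ln 2)\<^sup>2 < 1 - \<epsilon>\<^sub>0 / 2"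
    and "G \<in> borel_measurable M"
    and "U \<in> borel_measurable M"
    and "V \<in> borel_measurable M"
    and "\<And>\<omega>. \<omega> \<in> space M \<Longrightarrow> invertible (G \<omega>)"
    and "AE \<omega> in M. \<bar>det (G \<omega>)\<bar> = 1"
    and "\<And>\<omega>. \<omega> \<in> space M \<Longrightarrow> orthogonal_matrix (U \<omega>)"
    and "\<And>\<omega>. \<omega> \<in> space M \<Longrightarrow> orthogonal_matrix (V \<omega>)"
    and "AE \<omega> in M. G \<omega> = U \<omega> ** sv_diag (op_norm (G \<omega>)) ** V \<omega>"
    and "\<alpha> > 0"
    and "C > 0"
    and "\<And>\<delta>. \<delta> > 0 \<Longrightarrow>
           (SUP x\<in>{x :: real^2. norm x = 1}.
              measure M {\<omega> \<in> space M. \<bar>row 1 (V \<omega>) \<bullet> x\<bar> \<le> \<delta>}) \<le> C * \<delta> powr \<alpha>"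
    and "2 < A"
    and "A < B"
    and "A powr \<alpha> \<ge> C * 2 powr \<alpha> * B powr (2 * \<epsilon>\<^sub>0) / \<epsilon>\<^sub>0"
    and "AE \<omega> in M. A \<le> op_norm (G \<omega>) \<and> op_norm (G \<omega>) \<le> B"
  shows "(SUP x\<in>{x :: real^2. norm x = 1}.
            \<integral>\<^sup>+ \<omega>. ennreal (norm (G \<omega> *v x) powr (- 2 * \<epsilon>\<^sub>0)) \<partial>M) \<le> ennreal (1 - \<epsilon>\<^sub>0 / 4)"
proof (rule SUP_least)
  fix x :: "real^2"
  assume "x \<in> {x. norm x = 1}"
  hence x: "norm x = 1" by simp
  interpret prob_space M by fact
  note [measurable] = \<open>V \<in> borel_measurable M\<close>
  let ?t = "\<lambda>\<omega>. \<bar>row 1 (V \<omega>) \<bullet> x\<bar>"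
  define E where "E = {\<omega> \<in> space M. ?t \<omega> \<le> 2 / A}"
  define p where "p = 2 powr (- 2 * \<epsilon>\<^sub>0)"
  define q where "q = B powr (2 * \<epsilon>\<^sub>0)"
  have nonneg: "p \<ge> 0" "q \<ge> 0" and q: "q > 0"
    using assms(15,16) by (simp_all add: p_def q_def)

  have "(\<lambda>Q :: real^2^2. row 1 Q \<bullet> x) \<in> borel_measurable borel"
    by (intro borel_measurable_continuous_onI continuous_intros)
       (auto simp: row_def intro!: continuous_intros)
  from measurable_compose[OF \<open>V \<in> borel_measurable M\<close> this]
  have [measurable]: "(\<lambda>\<omega>. row 1 (V \<omega>) \<bullet> x) \<in> borel_measurable M" .
  have E [measurable]: "E \<in> sets M"
    unfolding E_def by measurable

  have "prob E \<le> (SUP x\<in>{x :: real^2. norm x = 1}. prob {\<omega> \<in> space M. \<bar>row 1 (V \<omega>) \<bullet> x\<bar> \<le> 2 / A})"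
    unfolding E_def by (rule cSUP_upper) (use x in \<open>auto intro!: bdd_aboveI[of _ 1]\<close>)
  also have "\<dots> \<le> C * (2 / A) powr \<alpha>"
    using assms(15) by (intro assms(14)) simp
  finally have "prob E \<le> C * 2 powr \<alpha> / A powr \<alpha>"
    using assms(15) by (simp add: powr_divide)
  moreover have "C * 2 powr \<alpha> * q \<le> \<epsilon>\<^sub>0 * A powr \<alpha>"
    using assms(2,17) by (simp add: q_def field_simps)
  hence "C * 2 powr \<alpha> / A powr \<alpha> * q \<le> \<epsilon>\<^sub>0"
    using assms(15) by (simp add: field_simps)
  ultimately have qE: "q * prob E \<le> \<epsilon>\<^sub>0"
    using q by (smt (verit) mult.commute mult_left_mono)

  have "AE \<omega> in M. ennreal (norm (G \<omega> *v x) powr (- 2 * \<epsilon>\<^sub>0)) \<le> ennreal p + ennreal q * indicator E \<omega>"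
    using assms(11,18) AE_space
  proof eventually_elim
    case (elim \<omega>)
    define s where "s = op_norm (G \<omega>)"
    have s: "A \<le> s" "s \<le> B" and svd: "G \<omega> = U \<omega> ** sv_diag s ** V \<omega>"
      using elim by (auto simp: s_def)
    have "1 \<le> s"
      using s assms(15) by simp
    note ge = norm_sv_decomposition_ge[OF assms(9,10)[OF elim(3)] x this, folded svd]
    show ?case
    proof (cases "\<omega> \<in> E")
      case True
      have "1 / B \<le> 1 / s"
        using s assms(15) by (intro divide_left_mono) auto
      with ge(2) have "1 / B \<le> norm (G \<omega> *v x)"
        by simp
      hence "norm (G \<omega> *v x) powr (- 2 * \<epsilon>\<^sub>0) \<le> (1 / B) powr (- 2 * \<epsilon>\<^sub>0)"
        using assms(2,15,16) by (intro powr_mono2') auto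
      also have "\<dots> = q"
        using assms(15,16) by (simp add: q_def powr_divide powr_minus)
      finally have "norm (G \<omega> *v x) powr (- 2 * \<epsilon>\<^sub>0) \<le> p + q"
        using nonneg by simp
      with True nonneg show ?thesis
        by (simp add: ennreal_plus[symmetric] del: ennreal_plus)
    next
      case False
      hence "2 / A < ?t \<omega>"
        using elim(3) by (simp add: E_def)
      hence "2 < A * ?t \<omega>"
        using assms(15) by (simp add: field_simps)
      also have "\<dots> \<le> s * ?t \<omega>"
        using s by (intro mult_right_mono) auto
      finally have "2 \<le> norm (G \<omega> *v x)"
        using ge(1) by simp
      hence "norm (G \<omega> *v x) powr (- 2 * \<epsilon>\<^sub>0) \<le> p"
        unfolding p_def using assms(2) by (intro powr_mono2') auto
      with False show ?thesis
        by (simp add: ennreal_leI)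
    qed
  qed
  hence "(\<integral>\<^sup>+ \<omega>. ennreal (norm (G \<omega> *v x) powr (- 2 * \<epsilon>\<^sub>0)) \<partial>M)
           \<le> (\<integral>\<^sup>+ \<omega>. ennreal p + ennreal q * indicator E \<omega> \<partial>M)"
    by (rule nn_integral_mono_AE)
  also have "\<dots> = ennreal p + ennreal q * emeasure M E"
    by (simp add: nn_integral_add nn_integral_cmult emeasure_space_1)
  also have "\<dots> = ennreal (p + q * prob E)"
    using nonneg by (simp add: emeasure_eq_measure ennreal_mult)
  also have "\<dots> \<le> ennreal (1 - \<epsilon>\<^sub>0 / 4)"
    using two_powr_neg_plus_le[OF assms(2,3)] qE by (intro ennreal_leI) (simp add: p_def)
  finally show "(\<integral>\<^sup>+ \<omega>. ennreal (norm (G \<omega> *v x) powr (- 2 * \<epsilon>\<^sub>0)) \<partial>M) \<le> ennreal (1 - \<epsilon>\<^sub>0 / 4)" .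
qed

end
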